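(* Let $(X,d)$ be a nonempty metric space and let $S,T,f: X\to X$ be mappings such that $SX\cup TX\subset fX$. Let $\alpha,\beta,\gamma,\delta\in[0,1)$ satisfy $\alpha+\beta+\gamma+2\delta<1$ and let $L\ge 0$. Assume that for all $x,y\in X$ $$d(Sx,Ty)\le \alpha\, d(fx,Sx)+\beta\, d(fy,Ty)+\gamma\, d(fx,fy)+\delta\,[d(fy,Sx)+d(fx,Ty)]+L\min\{d(fx,Sx),\,d(fy,Ty),\,d(fy,Sx),\,d(fx,Ty)\}.$$ If $(S,f)$ and $(T,f)$ are weakly compatible and $fX$ is a complete subspace of $X$, then $S$, $T$ and $f$ have a unique common fixed point in $X$, i.e. there is exactly one $z\in X$ with $Sz=Tz=fz=z$.
   Context: For a mapping $h:X\to X$, $hX$ denotes the image $\{hx : x\in X\}$; $\subset$ allows equality; a subset of $X$ is a complete subspace if it is complete in the metric induced by $d$. Two mappings $T,f:X\to X$ are weakly compatible if they commute at their coincidence points, i.e. $Tfx=fTx$ for every $x\in X$ with $Tx=fx$. *)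

theory Defs
  imports "HOL-Analysis.Analysis"
begin

definition weakly_compatible_on :: "'a set \<Rightarrow> ('a \<Rightarrow> 'a) \<Rightarrow> ('a \<Rightarrow> 'a) \<Rightarrow> bool" where
  "weakly_compatible_on X T f \<longleftrightarrow> (\<forall>x\<in>X. T x = f x \<longrightarrow> T (f x) = f (T x))"

end

theory Submission
  imports Defs
begin

text \<open>
  Start anywhere and use \<open>S X \<union> T X \<subseteq> f X\<close> to choose points \<open>x\<^sub>n\<close> with
  \<open>f x\<^sub>n\<^sub>+\<^sub>1 = S x\<^sub>n\<close> for even \<open>n\<close> and \<open>f x\<^sub>n\<^sub>+\<^sub>1 = T x\<^sub>n\<close> for odd \<open>n\<close>.
  Whenever \<open>f y = S x\<close>, one of the four distances in the minimum vanishes, so the \<open>L\<close>-term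
  disappears and the contractive condition becomes a linear inequality between consecutive steps of
  the orbit \<open>f x\<^sub>n\<close>. Its solution is a ratio below 1 precisely because
  \<open>\<alpha> + \<beta> + \<gamma> + 2\<delta> < 1\<close> (lemmas \<open>step_contracts\<close> and \<open>step_ratio\<close>). Hence the orbit is Cauchy, and as
  \<open>f X\<close> is complete it converges to some \<open>f u\<close>. Comparing \<open>S u\<close> with
  \<open>T x\<^sub>n\<close> for odd \<open>n\<close>, the minimum is bounded by a step of the orbit and
  so tends to 0; what is left forces \<open>S u = f u\<close> (lemma \<open>coincidence_exists\<close>), and then the
  condition at \<open>(u, u)\<close> forces \<open>T u = f u\<close> (lemma \<open>coincidence_transfers\<close>).

  The remainder is algebraic. If \<open>S x = f x\<close> and \<open>T y = f y\<close>, then \<open>d (f x) (S x) = 0\<close>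
  again kills the minimum, and the condition collapses to
  \<open>d (f x) (f y) \<le> (\<gamma> + 2\<delta>) d (f x) (f y)\<close>, that is, \<open>f x = f y\<close>
  (lemma \<open>coincidence_value_unique\<close>). By weak compatibility the point \<open>z = f u\<close> is itself a
  coincidence point of both pairs, so \<open>f z = f u = z\<close>; the same lemma gives uniqueness.
\<close>

section \<open>Sequences with geometrically decreasing steps\<close>

lemma (in Metric_space) MCauchy_if_steps_contract:
  fixes k :: real
  assumes \<sigma>: "range \<sigma> \<subseteq> M" and k: "0 \<le> k" "k < 1"
    and step: "\<And>n. d (\<sigma> (Suc n)) (\<sigma> (Suc (Suc n))) \<le> k * d (\<sigma> n) (\<sigma> (Suc n))"
  shows "MCauchy \<sigma>"
proof -
  have \<sigma>M: "\<sigma> n \<in> M" for n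
    using \<sigma> by auto
  define c where "c = d (\<sigma> 0) (\<sigma> 1)"
  have c: "c \<ge> 0"
    by (simp add: c_def)
  have geo: "d (\<sigma> n) (\<sigma> (Suc n)) \<le> c * k ^ n" for n
  proof (induction n)
    case 0
    then show ?case by (simp add: c_def)
  next
    case (Suc n)
    have "d (\<sigma> (Suc n)) (\<sigma> (Suc (Suc n))) \<le> k * d (\<sigma> n) (\<sigma> (Suc n))"
      by (rule step)
    also have "\<dots> \<le> k * (c * k ^ n)"
      using Suc k by (intro mult_left_mono)
    finally show ?case by (simp add: mult_ac)
  qed
  \<comment> \<open>Splitting off the first step instead of the last keeps the bound independent of \<open>j\<close>:
    it is the full tail of the geometric series, which reproduces itself.\<close>
  have tail: "d (\<sigma> n) (\<sigma> (n + j)) \<le> c * k ^ n / (1 - k)" for n j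
  proof (induction j arbitrary: n)
    case 0
    then show ?case using c k \<sigma>M by simp
  next
    case (Suc j)
    have "d (\<sigma> n) (\<sigma> (n + Suc j)) \<le> d (\<sigma> n) (\<sigma> (Suc n)) + d (\<sigma> (Suc n)) (\<sigma> (Suc n + j))"
      using triangle[OF \<sigma>M \<sigma>M \<sigma>M] by simp
    also have "\<dots> \<le> c * k ^ n + c * k ^ Suc n / (1 - k)"
      by (intro add_mono geo Suc)
    also have "\<dots> = c * k ^ n / (1 - k)"
      using k by (simp add: field_simps)
    finally show ?case .
  qed
  have "(\<lambda>n. c * k ^ n / (1 - k)) \<longlonglongrightarrow> c * 0 / (1 - k)"
    using k by (intro tendsto_intros LIMSEQ_realpow_zero) auto
  then have lim: "(\<lambda>n. c * k ^ n / (1 - k)) \<longlonglongrightarrow> 0"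
    by simp
  show ?thesis
    unfolding MCauchy_def
  proof (intro conjI allI impI)
    fix \<epsilon> :: real
    assume "\<epsilon> > 0"
    with lim have "\<forall>\<^sub>F n in sequentially. c * k ^ n / (1 - k) < \<epsilon> / 2"
      by (intro order_tendstoD) auto
    then obtain N where N: "c * k ^ N / (1 - k) < \<epsilon> / 2"
      by (auto simp: eventually_sequentially)
    have near: "d (\<sigma> N) (\<sigma> n) < \<epsilon> / 2" if "N \<le> n" for n
      using le_less_trans[OF tail[of N "n - N"] N] that by simp
    have "d (\<sigma> n) (\<sigma> n') < \<epsilon>" if "N \<le> n" "N \<le> n'" for n n'
      using near[OF that(1)] near[OF that(2)] triangle''[OF \<sigma>M[of n] \<sigma>M[of N] \<sigma>M[of n']] by linarith
    then show "\<exists>N. \<forall>n n'. N \<le> n \<longrightarrow> N \<le> n' \<longrightarrow> d (\<sigma> n) (\<sigma> n') < \<epsilon>"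
      by blast
  qed (rule \<sigma>)
qed

section \<open>Almost contractive pairs relative to a third map\<close>

locale almost_contractive_pair = Metric_space X d
  for X :: "'a set" and d :: "'a \<Rightarrow> 'a \<Rightarrow> real" +
  fixes S T f :: "'a \<Rightarrow> 'a" and \<alpha> \<beta> \<gamma> \<delta> L :: real
  assumes S_in: "x \<in> X \<Longrightarrow> S x \<in> X" and T_in: "x \<in> X \<Longrightarrow> T x \<in> X"
    and f_in: "x \<in> X \<Longrightarrow> f x \<in> X"
    and coeff_nonneg: "\<alpha> \<ge> 0" "\<beta> \<ge> 0" "\<gamma> \<ge> 0" "\<delta> \<ge> 0"
    and coeff_sum: "\<alpha> + \<beta> + \<gamma> + 2 * \<delta> < 1"
    and L_nonneg: "L \<ge> 0"
    and contractive: "\<lbrakk>x \<in> X; y \<in> X\<rbrakk> \<Longrightarrow>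
      d (S x) (T y) \<le> \<alpha> * d (f x) (S x) + \<beta> * d (f y) (T y) + \<gamma> * d (f x) (f y)
        + \<delta> * (d (f y) (S x) + d (f x) (T y))
        + L * Min {d (f x) (S x), d (f y) (T y), d (f y) (S x), d (f x) (T y)}"
begin

text \<open>
  Every use of the contractive condition needs only one of the four distances in the minimum.
\<close>

lemma contractive_with:
  assumes "x \<in> X" "y \<in> X"
    and m: "m \<in> {d (f x) (S x), d (f y) (T y), d (f y) (S x), d (f x) (T y)}"
  shows "d (S x) (T y) \<le> \<alpha> * d (f x) (S x) + \<beta> * d (f y) (T y) + \<gamma> * d (f x) (f y)
           + \<delta> * (d (f y) (S x) + d (f x) (T y)) + L * m"
proof -
  have "L * Min {d (f x) (S x), d (f y) (T y), d (f y) (S x), d (f x) (T y)} \<le> L * m"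
    using m L_nonneg by (intro mult_left_mono Min_le) auto
  with contractive[OF assms(1,2)] show ?thesis
    by linarith
qed

text \<open>
  The hypotheses are symmetric under exchanging \<open>S\<close> with \<open>T\<close> together with \<open>\<alpha>\<close> with
  \<open>\<beta>\<close>. This makes the odd steps of the orbit an instance of the even ones.
\<close>

lemma swapped: "almost_contractive_pair X d T S f \<beta> \<alpha> \<gamma> \<delta> L"
proof unfold_locales
  fix x y
  assume xy: "x \<in> X" "y \<in> X"
  have "{d (f x) (T x), d (f y) (S y), d (f y) (T x), d (f x) (S y)}
      = {d (f y) (S y), d (f x) (T x), d (f x) (S y), d (f y) (T x)}"
    by auto
  then show "d (T x) (S y) \<le> \<beta> * d (f x) (T x) + \<alpha> * d (f y) (S y) + \<gamma> * d (f x) (f y)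
        + \<delta> * (d (f y) (T x) + d (f x) (S y))
        + L * Min {d (f x) (T x), d (f y) (S y), d (f y) (T x), d (f x) (S y)}"
    using contractive[OF xy(2,1)] by (simp add: commute add_ac)
qed (use S_in T_in f_in coeff_nonneg coeff_sum L_nonneg in auto)

text \<open>
  Write \<open>a = d (f x) (f y)\<close> and \<open>b = d (f y) (T y)\<close>. As \<open>d (f y) (S x) = 0\<close>, the minimum vanishes,
  and the triangle inequality \<open>d (f x) (T y) \<le> a + b\<close> leaves
  \<open>(1 - \<beta> - \<delta>) b \<le> (\<alpha> + \<gamma> + \<delta>) a\<close>.
\<close>

lemma step_contracts:
  assumes x: "x \<in> X" and y: "y \<in> X" and fy: "f y = S x"
  shows "d (f y) (T y) \<le> (\<alpha> + \<gamma> + \<delta>) / (1 - \<beta> - \<delta>) * d (f x) (f y)"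
proof -
  have "f y \<in> X"
    using f_in y by blast
  then have "d (f y) (T y) \<le> \<alpha> * d (f x) (f y) + \<beta> * d (f y) (T y) + \<gamma> * d (f x) (f y)
      + \<delta> * d (f x) (T y)"
    using contractive_with[OF x y, of "d (f y) (S x)"] by (simp flip: fy)
  moreover have "\<delta> * d (f x) (T y) \<le> \<delta> * (d (f x) (f y) + d (f y) (T y))"
    using coeff_nonneg x y by (intro mult_left_mono triangle f_in T_in)
  ultimately have "(1 - \<beta> - \<delta>) * d (f y) (T y) \<le> (\<alpha> + \<gamma> + \<delta>) * d (f x) (f y)"
    by (simp add: algebra_simps)
  moreover have "1 - \<beta> - \<delta> > 0"
    using coeff_nonneg coeff_sum by linarith
  ultimately show ?thesis
    by (simp add: field_simps)
qed

lemma step_ratio: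
  "0 \<le> (\<alpha> + \<gamma> + \<delta>) / (1 - \<beta> - \<delta>)" "(\<alpha> + \<gamma> + \<delta>) / (1 - \<beta> - \<delta>) < 1"
proof -
  have "1 - \<beta> - \<delta> > 0"
    using coeff_nonneg coeff_sum by linarith
  then show "0 \<le> (\<alpha> + \<gamma> + \<delta>) / (1 - \<beta> - \<delta>)" "(\<alpha> + \<gamma> + \<delta>) / (1 - \<beta> - \<delta>) < 1"
    using coeff_nonneg coeff_sum by auto
qed

lemma coincidence_value_unique:
  assumes x: "x \<in> X" "S x = f x" and y: "y \<in> X" "T y = f y"
  shows "f x = f y"
proof -
  have f: "f x \<in> X" "f y \<in> X"
    using x y f_in by auto
  have "d (f x) (f y) \<le> \<gamma> * d (f x) (f y) + \<delta> * (d (f x) (f y) + d (f x) (f y))"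
    using contractive_with[OF x(1) y(1), of "d (f x) (S x)"] f
    by (simp add: x y commute)
  then have "(1 - \<gamma> - 2 * \<delta>) * d (f x) (f y) \<le> 0"
    by (simp add: algebra_simps)
  moreover have "1 - \<gamma> - 2 * \<delta> > 0"
    using coeff_nonneg coeff_sum by linarith
  ultimately have "d (f x) (f y) = 0"
    using nonneg[of "f x" "f y"] by (simp add: mult_le_0_iff)
  with f show ?thesis by simp
qed

text \<open>
  A point at which \<open>S\<close> and \<open>f\<close> agree is automatically a coincidence point of \<open>T\<close> as well,
  so the limit argument has to be carried out for \<open>S\<close> only.
\<close>

lemma coincidence_transfers:
  assumes u: "u \<in> X" "S u = f u"
  shows "T u = f u"
proof -
  have f: "f u \<in> X" "T u \<in> X"
    using u f_in T_in by auto
  have "d (f u) (T u) \<le> \<beta> * d (f u) (T u) + \<delta> * d (f u) (T u)"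
    using contractive_with[OF u(1) u(1), of "d (f u) (S u)"] f by (simp add: u)
  then have "(1 - \<beta> - \<delta>) * d (f u) (T u) \<le> 0"
    by (simp add: algebra_simps)
  moreover have "1 - \<beta> - \<delta> > 0"
    using coeff_nonneg coeff_sum by linarith
  ultimately have "d (f u) (T u) = 0"
    using nonneg[of "f u" "T u"] by (simp add: mult_le_0_iff)
  with f show ?thesis by simp
qed

text \<open>
  The distance from \<open>f u\<close> to \<open>S u\<close> is controlled by how close \<open>f y\<close> and \<open>T y\<close> are to \<open>f u\<close>,
  for any \<open>y\<close>. Along the orbit the right-hand side tends to 0, and this
  is how the limit of the orbit is recognised as a coincidence value.
\<close>

lemma coincidence_defect_bound:
  assumes u: "u \<in> X" and y: "y \<in> X"
  shows "(1 - \<alpha> - \<delta>) * d (f u) (S u)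
    \<le> (\<beta> + \<gamma> + \<delta> + L) * d (f y) (f u) + (1 + \<beta> + \<delta> + L) * d (T y) (f u)"
proof -
  note [simp] = f_in S_in T_in u y
  define D e g where "D = d (f u) (S u)" and "e = d (f y) (f u)" and "g = d (T y) (f u)"
  note defs = D_def e_def g_def
  have "D \<le> d (S u) (T y) + g"
    using triangle[of "S u" "T y" "f u"] by (simp add: defs commute)
  also have "d (S u) (T y) \<le> \<alpha> * D + \<beta> * d (f y) (T y) + \<gamma> * e
      + \<delta> * (d (f y) (S u) + g) + L * d (f y) (T y)"
    using contractive_with[OF u y, of "d (f y) (T y)"] by (simp add: defs commute)
  also have "\<beta> * d (f y) (T y) \<le> \<beta> * (e + g)"
    using coeff_nonneg by (intro mult_left_mono) (simp_all add: defs triangle')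
  also have "\<delta> * (d (f y) (S u) + g) \<le> \<delta> * ((e + D) + g)"
    using coeff_nonneg by (intro mult_left_mono add_right_mono) (simp_all add: defs triangle)
  also have "L * d (f y) (T y) \<le> L * (e + g)"
    using L_nonneg by (intro mult_left_mono) (simp_all add: defs triangle')
  finally have "D \<le> \<alpha> * D + \<beta> * (e + g) + \<gamma> * e + \<delta> * (e + D + g) + L * (e + g) + g"
    by simp
  then show ?thesis
    unfolding defs by (simp add: algebra_simps)
qed

lemma coincidence_exists:
  assumes ne: "X \<noteq> {}" and im: "S ` X \<union> T ` X \<subseteq> f ` X"
    and compl: "Metric_space.mcomplete (f ` X) d"
  shows "\<exists>u\<in>X. S u = f u \<and> T u = f u"
proof -
  have "\<exists>x'. x' \<in> X \<and> f x' = (if even n then S x else T x)" if "x \<in> X" for x and n :: nat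
  proof -
    have "(if even n then S x else T x) \<in> f ` X"
      using im that by auto
    then show ?thesis by (auto simp: image_iff)
  qed
  then have "\<exists>x. \<forall>n. x n \<in> X \<and> f (x (Suc n)) = (if even n then S (x n) else T (x n))"
    using ne by (intro dependent_nat_choice) auto
  then obtain x where x_in: "\<And>n. x n \<in> X"
    and x_Suc: "\<And>n. f (x (Suc n)) = (if even n then S (x n) else T (x n))"
    by blast
  define \<sigma> where "\<sigma> = (\<lambda>n. f (x n))"
  have \<sigma>_in: "range \<sigma> \<subseteq> X"
    using x_in f_in by (auto simp: \<sigma>_def)
  interpret sw: almost_contractive_pair X d T S f \<beta> \<alpha> \<gamma> \<delta> L
    by (rule swapped)
  \<comment> \<open>Even and odd steps contract with different ratios; the larger one serves for both.\<close>
  define k where "k = max ((\<alpha> + \<gamma> + \<delta>) / (1 - \<beta> - \<delta>)) ((\<beta> + \<gamma> + \<delta>) / (1 - \<alpha> - \<delta>))"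
  have step: "d (\<sigma> (Suc n)) (\<sigma> (Suc (Suc n))) \<le> k * d (\<sigma> n) (\<sigma> (Suc n))" for n
  proof -
    have "d (\<sigma> (Suc n)) (\<sigma> (Suc (Suc n))) \<le> (if even n then (\<alpha> + \<gamma> + \<delta>) / (1 - \<beta> - \<delta>)
        else (\<beta> + \<gamma> + \<delta>) / (1 - \<alpha> - \<delta>)) * d (\<sigma> n) (\<sigma> (Suc n))"
      using step_contracts[OF x_in[of n] x_in[of "Suc n"]]
        sw.step_contracts[OF x_in[of n] x_in[of "Suc n"]]
      by (cases "even n") (simp_all add: \<sigma>_def x_Suc)
    also have "\<dots> \<le> k * d (\<sigma> n) (\<sigma> (Suc n))"
      by (intro mult_right_mono) (auto simp: k_def)
    finally show ?thesis .
  qed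
  have "MCauchy \<sigma>"
    by (rule MCauchy_if_steps_contract[where k = k])
      (use \<sigma>_in step step_ratio sw.step_ratio in \<open>auto simp: k_def le_max_iff_disj\<close>)
  interpret fX: Submetric X d "f ` X"
    by unfold_locales (use f_in in auto)
  have "fX.sub.MCauchy \<sigma>"
    using \<open>MCauchy \<sigma>\<close> x_in by (auto simp: fX.MCauchy_submetric \<sigma>_def)
  with compl obtain p where "limitin fX.sub.mtopology \<sigma> p sequentially"
    unfolding fX.sub.mcomplete_def by blast
  then have "p \<in> f ` X" and lim: "(\<lambda>n. d (\<sigma> n) p) \<longlonglongrightarrow> 0"
    by (auto simp: fX.sub.limitin_metric_dist_null)
  then obtain u where u: "u \<in> X" and p: "p = f u"
    by blast
  have bound: "(1 - \<alpha> - \<delta>) * d (f u) (S u)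
      \<le> (\<beta> + \<gamma> + \<delta> + L) * d (\<sigma> (2 * n + 1)) p + (1 + \<beta> + \<delta> + L) * d (\<sigma> (2 * n + 2)) p" for n
    using coincidence_defect_bound[OF u x_in[of "2 * n + 1"]] x_Suc[of "2 * n + 1"]
    by (simp add: \<sigma>_def p)
  have odd_lim: "(\<lambda>n. d (\<sigma> (2 * n + 1)) p) \<longlonglongrightarrow> 0"
    using LIMSEQ_subseq_LIMSEQ[OF lim, of "\<lambda>n. 2 * n + 1"]
    by (simp add: strict_mono_def o_def)
  have even_lim: "(\<lambda>n. d (\<sigma> (2 * n + 2)) p) \<longlonglongrightarrow> 0"
    using LIMSEQ_subseq_LIMSEQ[OF lim, of "\<lambda>n. 2 * n + 2"]
    by (simp add: strict_mono_def o_def)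
  have "(\<lambda>n. (\<beta> + \<gamma> + \<delta> + L) * d (\<sigma> (2 * n + 1)) p + (1 + \<beta> + \<delta> + L) * d (\<sigma> (2 * n + 2)) p)
      \<longlonglongrightarrow> (\<beta> + \<gamma> + \<delta> + L) * 0 + (1 + \<beta> + \<delta> + L) * 0"
    by (intro tendsto_intros odd_lim even_lim)
  then have "(1 - \<alpha> - \<delta>) * d (f u) (S u) \<le> (\<beta> + \<gamma> + \<delta> + L) * 0 + (1 + \<beta> + \<delta> + L) * 0"
    by (rule LIMSEQ_le_const) (use bound in blast)
  moreover have "1 - \<alpha> - \<delta> > 0"
    using coeff_nonneg coeff_sum by linarith
  ultimately have "d (f u) (S u) = 0"
    using nonneg[of "f u" "S u"] by (simp add: mult_le_0_iff)
  with u f_in S_in have "S u = f u"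
    by simp
  with coincidence_transfers u show ?thesis by blast
qed

end

section \<open>The common fixed point\<close>

theorem theorem2:
  fixes X :: "'a set" and d :: "'a \<Rightarrow> 'a \<Rightarrow> real"
    and S T f :: "'a \<Rightarrow> 'a"
    and \<alpha> \<beta> \<gamma> \<delta> L :: real
  assumes "Metric_space X d" and "X \<noteq> {}"
    and "S \<in> X \<rightarrow> X" and "T \<in> X \<rightarrow> X" and "f \<in> X \<rightarrow> X"
    and "S ` X \<union> T ` X \<subseteq> f ` X"
    and "\<alpha> \<in> {0..<1}" and "\<beta> \<in> {0..<1}" and "\<gamma> \<in> {0..<1}" and "\<delta> \<in> {0..<1}"
    and "\<alpha> + \<beta> + \<gamma> + 2 * \<delta> < 1"
    and "L \<ge> 0"
    and "\<And>x y. x \<in> X \<Longrightarrow> y \<in> X \<Longrightarrow>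
      d (S x) (T y) \<le> \<alpha> * d (f x) (S x) + \<beta> * d (f y) (T y) + \<gamma> * d (f x) (f y)
        + \<delta> * (d (f y) (S x) + d (f x) (T y))
        + L * Min {d (f x) (S x), d (f y) (T y), d (f y) (S x), d (f x) (T y)}"
    and "weakly_compatible_on X S f" and "weakly_compatible_on X T f"
    and "Metric_space.mcomplete (f ` X) d"
  shows "\<exists>!z. z \<in> X \<and> S z = z \<and> T z = z \<and> f z = z"
proof -
  interpret almost_contractive_pair X d S T f \<alpha> \<beta> \<gamma> \<delta> L
    by (intro almost_contractive_pair.intro almost_contractive_pair_axioms.intro)
      (use assms in auto)
  obtain u where u: "u \<in> X" "S u = f u" "T u = f u"
    using coincidence_exists[OF assms(2,6,16)] by blast
  define z where "z = f u"
  have zX: "z \<in> X"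
    using u f_in by (simp add: z_def)
  have Sz: "S z = f z" and Tz: "T z = f z"
    using assms(14,15) u by (auto simp: weakly_compatible_on_def z_def)
  have fz: "f z = z"
    using coincidence_value_unique[OF zX Sz u(1,3)] by (simp add: z_def)
  show ?thesis
  proof (intro ex1I conjI)
    fix w
    assume "w \<in> X \<and> S w = w \<and> T w = w \<and> f w = w"
    then show "w = z"
      using coincidence_value_unique[of w z] zX Tz fz by simp
  qed (use zX Sz Tz fz in auto)
qed

end
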